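(* Let $\mathbb{X}$ be a real Banach space. Then $x \in \mathbb{X}$ is a right-symmetric point in $\mathbb{X}$ if and only if for every $u \in \mathbb{X}$ the following two conditions hold: (i) $x \in u^{-}$ implies that $u \in x^{-}$; (ii) $x \in u^{+}$ implies that $u \in x^{+}$.
   Context: For $x,y$ in a real Banach space $\mathbb{X}$, $x$ is Birkhoff-James orthogonal to $y$, written $x \perp_B y$, if $\|x+\lambda y\| \geq \|x\|$ for all $\lambda \in \mathbb{R}$. An element $x \in \mathbb{X}$ is a right-symmetric point in $\mathbb{X}$ if for every $y \in \mathbb{X}$, $y \perp_B x$ implies $x \perp_B y$. For $x \in \mathbb{X}$, define $x^{+} = \{y \in \mathbb{X} : \|x+\lambda y\| \geq \|x\| \text{ for all } \lambda \geq 0\}$ and $x^{-} = \{y \in \mathbb{X} : \|x+\lambda y\| \geq \|x\| \text{ for all } \lambda \leq 0\}$. *)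

theory Defs
  imports "HOL-Analysis.Analysis"
begin

definition bj_orthogonal :: "'a::real_normed_vector \<Rightarrow> 'a \<Rightarrow> bool"  (infix "\<bottom>\<^sub>B" 50) where
  "x \<bottom>\<^sub>B y \<longleftrightarrow> (\<forall>t::real. norm (x + t *\<^sub>R y) \<ge> norm x)"

definition right_symmetric_point :: "'a::real_normed_vector \<Rightarrow> bool" where
  "right_symmetric_point x \<longleftrightarrow> (\<forall>y. y \<bottom>\<^sub>B x \<longrightarrow> x \<bottom>\<^sub>B y)"

definition bj_plus :: "'a::real_normed_vector \<Rightarrow> 'a set" where
  "bj_plus x = {y. \<forall>t::real. t \<ge> 0 \<longrightarrow> norm (x + t *\<^sub>R y) \<ge> norm x}"

definition bj_minus :: "'a::real_normed_vector \<Rightarrow> 'a set" where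
  "bj_minus x = {y. \<forall>t::real. t \<le> 0 \<longrightarrow> norm (x + t *\<^sub>R y) \<ge> norm x}"

end

theory Submission
  imports Defs
begin

text \<open>
  If \<open>x \<in> u\<^sup>+\<close>, then \<open>t \<mapsto> \<parallel>u + t x\<parallel>\<close> attains its minimum at some \<open>-s \<le> 0\<close>, so that
  \<open>v = u - s x\<close> is orthogonal to \<open>x\<close>. Right-symmetry gives \<open>x \<bottom>\<^sub>B v\<close>, hence for \<open>t \<ge> 0\<close>
  \<open>\<parallel>x + t u\<parallel> = \<parallel>(1 + t s) x + t v\<parallel> \<ge> (1 + t s) \<parallel>x\<parallel> \<ge> \<parallel>x\<parallel>\<close>. The statement for
  \<open>u\<^sup>-\<close> is the one for \<open>(-u)\<^sup>+\<close>.
\<close>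

lemma bj_orthogonal_iff_plus_minus:
  "x \<bottom>\<^sub>B y \<longleftrightarrow> y \<in> bj_plus x \<and> y \<in> bj_minus x"
  unfolding bj_orthogonal_def bj_plus_def bj_minus_def mem_Collect_eq using linear by blast

lemma bj_minus_iff_plus_uminus_right: "y \<in> bj_minus x \<longleftrightarrow> -y \<in> bj_plus x"
proof -
  have "(\<forall>t\<le>0. P t) \<longleftrightarrow> (\<forall>t\<ge>0. P (-t))" for P :: "real \<Rightarrow> bool"
    by (metis minus_minus neg_0_le_iff_le)
  from this[of "\<lambda>t. norm (x + t *\<^sub>R y) \<ge> norm x"] show ?thesis
    by (simp add: bj_plus_def bj_minus_def)
qed

lemma bj_minus_iff_plus_uminus_left: "y \<in> bj_minus x \<longleftrightarrow> y \<in> bj_plus (-x)"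
proof -
  have "norm (x + t *\<^sub>R (-y)) = norm (-x + t *\<^sub>R y)" for t
    using norm_minus_cancel[of "x + t *\<^sub>R (-y)"] by simp
  then show ?thesis
    unfolding bj_minus_iff_plus_uminus_right bj_plus_def mem_Collect_eq norm_minus_cancel by metis
qed

lemma bj_plus_obtains_orthogonal:
  assumes "x \<in> bj_plus u" and "x \<noteq> 0"
  obtains s where "s \<ge> 0" and "(u - s *\<^sub>R x) \<bottom>\<^sub>B x"
proof -
  define f where "f t = norm (u + t *\<^sub>R x)" for t
  \<comment> \<open>For \<open>t < -M\<close> the triangle inequality gives
    \<open>f t \<ge> \<bar>t\<bar> * norm x - norm u \<ge> norm u = f 0\<close>, while
    \<open>t \<ge> 0\<close> is covered by the hypothesis. Hence a minimum over the compact interval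
    from \<open>-M\<close> to 0 is global.\<close>
  define M where "M = 2 * norm u / norm x"
  have "M \<ge> 0" by (simp add: M_def)
  have "continuous_on {-M..0} f" unfolding f_def by (intro continuous_intros)
  then obtain m where m: "m \<in> {-M..0}" and min: "\<forall>t\<in>{-M..0}. f m \<le> f t"
    using continuous_attains_inf[of "{-M..0}" f] \<open>M \<ge> 0\<close> by auto
  have "f m \<le> f 0" using min \<open>M \<ge> 0\<close> by simp
  have f_min: "f m \<le> f t" for t
  proof (cases "t \<in> {-M..0}")
    case True
    then show ?thesis using min by blast
  next
    case False
    have "f 0 \<le> f t"
    proof (cases "t \<ge> 0")
      case True
      then show ?thesis using assms(1) by (simp add: f_def bj_plus_def)
    next
      case neg: False
      with False have "M * norm x \<le> \<bar>t\<bar> * norm x" by (intro mult_right_mono) auto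
      then have "2 * norm u \<le> norm (t *\<^sub>R x)" using assms(2) by (simp add: M_def)
      then show ?thesis
        using norm_diff_ineq[of "t *\<^sub>R x" u] by (simp add: f_def add.commute)
    qed
    with \<open>f m \<le> f 0\<close> show ?thesis by simp
  qed
  show thesis
  proof
    show "- m \<ge> 0" using m by simp
    \<comment> \<open>Adding multiples of x to the minimizer stays on the line parametrized by
      \<open>f\<close>, so global minimality at \<open>m\<close> is exactly orthogonality to
      x.\<close>
    have "norm (u - (-m) *\<^sub>R x + t *\<^sub>R x) = f (m + t)" for t
      by (simp add: f_def scaleR_add_left add.assoc)
    then show "(u - (-m) *\<^sub>R x) \<bottom>\<^sub>B x"
      using f_min by (simp add: bj_orthogonal_def f_def)
  qed
qed

lemma bj_orthogonal_imp_plus: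
  assumes "x \<bottom>\<^sub>B v" and "s \<ge> 0"
  shows "v + s *\<^sub>R x \<in> bj_plus x"
  unfolding bj_plus_def mem_Collect_eq
proof (intro allI impI)
  fix t :: real
  assume "t \<ge> 0"
  \<comment> \<open>This is the total coefficient of x in
    \<open>x + t *\<^sub>R (v + s *\<^sub>R x)\<close>. Factoring it out leaves a vector of the form
    to which \<open>x \<bottom>\<^sub>B v\<close> applies.\<close>
  define c where "c = 1 + t * s"
  have "c \<ge> 1" using \<open>t \<ge> 0\<close> \<open>s \<ge> 0\<close> by (simp add: c_def)
  have "norm x \<le> c * norm x" using \<open>c \<ge> 1\<close> by (simp add: mult_le_cancel_right1)
  also have "\<dots> \<le> c * norm (x + (t / c) *\<^sub>R v)"
    using assms(1) \<open>c \<ge> 1\<close> by (intro mult_left_mono) (auto simp: bj_orthogonal_def)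
  also have "\<dots> = norm (c *\<^sub>R (x + (t / c) *\<^sub>R v))" using \<open>c \<ge> 1\<close> by simp
  also have "c *\<^sub>R (x + (t / c) *\<^sub>R v) = x + t *\<^sub>R (v + s *\<^sub>R x)"
    using \<open>c \<ge> 1\<close> by (simp add: scaleR_add_right) (simp add: c_def scaleR_add_left)
  finally show "norm x \<le> norm (x + t *\<^sub>R (v + s *\<^sub>R x))" .
qed

lemma right_symmetric_point_bj_plus:
  assumes "right_symmetric_point x" and "x \<in> bj_plus u"
  shows "u \<in> bj_plus x"
proof (cases "x = 0")
  \<comment> \<open>The minimum argument divides by \<open>norm x\<close>, so x = 0 is treated
    apart: every vector lies in \<open>bj_plus 0\<close>.\<close>
  case True
  then show ?thesis by (simp add: bj_plus_def)
next
  case False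
  then obtain s where "s \<ge> 0" and "(u - s *\<^sub>R x) \<bottom>\<^sub>B x"
    using bj_plus_obtains_orthogonal assms(2) by blast
  then have "x \<bottom>\<^sub>B (u - s *\<^sub>R x)" using assms(1) by (simp add: right_symmetric_point_def)
  from bj_orthogonal_imp_plus[OF this \<open>s \<ge> 0\<close>] show ?thesis by simp
qed

theorem theorem2p2:
  fixes x :: "'a::banach"
  shows "right_symmetric_point x \<longleftrightarrow>
    (\<forall>u. (x \<in> bj_minus u \<longrightarrow> u \<in> bj_minus x) \<and> (x \<in> bj_plus u \<longrightarrow> u \<in> bj_plus x))"
proof
  assume "right_symmetric_point x"
  note plus = right_symmetric_point_bj_plus[OF this]
  \<comment> \<open>The sign moves to the base point in the premise and to the direction in the
    conclusion, so both become statements about \<open>-u\<close>.\<close>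
  have "u \<in> bj_minus x" if "x \<in> bj_minus u" for u
    using plus[of "-u"] that bj_minus_iff_plus_uminus_left[of x u]
      bj_minus_iff_plus_uminus_right[of u x] by blast
  with plus show "\<forall>u. (x \<in> bj_minus u \<longrightarrow> u \<in> bj_minus x) \<and> (x \<in> bj_plus u \<longrightarrow> u \<in> bj_plus x)"
    by blast
next
  assume "\<forall>u. (x \<in> bj_minus u \<longrightarrow> u \<in> bj_minus x) \<and> (x \<in> bj_plus u \<longrightarrow> u \<in> bj_plus x)"
  \<comment> \<open>Orthogonality splits into its two one-sided halves, and each condition reverses
    one of them.\<close>
  then show "right_symmetric_point x"
    by (auto simp: right_symmetric_point_def bj_orthogonal_iff_plus_minus)
qed

end
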